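(* Let $n,d,p\ge 1$ be integers and let $E^{ID}, E^{f1},\dots,E^{fp}\in\mathbb{R}^{n\times d}$ (input item and attribute embeddings). Let $m \ge 1$, let $Y$ be a set of labels, $y\in Y$, and let $\ell:\mathbb{R}^m\times Y\to\mathbb{R}$ be a loss function. (1) Let $G:\mathbb{R}^{n\times d}\to\mathbb{R}^m$ be a model, and suppose $G$ and $\ell(\cdot,y)$ are differentiable. For the loss $$L(E^{ID},E^{f1},\dots,E^{fp}) = \ell\Big(G\big(E^{ID}+\sum_{i=1}^p E^{fi}\big),\,y\Big),$$ the gradients of $L$ with respect to $E^{ID}, E^{f1},\dots,E^{fp}$ are all the same: $$\nabla_{E^{ID}}L = \nabla_{E^{f1}}L=\dots=\nabla_{E^{fp}}L,$$ for every such $\ell$ and $G$, every input $(E^{ID},E^{f1},\dots,E^{fp})$ and every label $y$. (2) Let $G:\mathbb{R}^{n\times d}\times\mathbb{R}^{n\times d}\to\mathbb{R}^m$ be a model, and suppose $G$ and $\ell(\cdot,y)$ are differentiable. For the loss $$L(E^{ID},E^{f1},\dots,E^{fp}) = \ell\Big(G\big(E^{ID},\,\sum_{i=1}^p E^{fi}\big),\,y\Big),$$ the gradients of $L$ with respect to $E^{f1},\dots,E^{fp}$ are all the same: $$\nabla_{E^{f1}}L=\dots=\nabla_{E^{fp}}L,$$ for every such $\ell$ and $G$, every input $(E^{ID},E^{f1},\dots,E^{fp})$ and every label $y$.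
   Context: The superscripts $ID$ and $fi$ are labels, not powers. $\nabla_{E}L\in\mathbb{R}^{n\times d}$ denotes the gradient of $L$ with respect to the matrix variable $E\in\mathbb{R}^{n\times d}$, the other variables being held fixed, where $L$ is regarded as a function of the $p+1$ independent matrix variables $E^{ID},E^{f1},\dots,E^{fp}$, evaluated at the given input. The loss in (1) corresponds to a model in which all embeddings are added before being fed to the model; the loss in (2) corresponds to a model in which attribute embeddings are summed first and fed to the model as a separate argument from the item embedding. *)

theory Defs
  imports "HOL-Analysis.Analysis"
begin

text \<open>On \<^typ>\<open>real^'d^'n\<close> the inner product is the Frobenius inner product, so a gradient in the
  sense of the library's \<open>GDERIV\<close> is the matrix of partial derivatives (\<open>grad_nth_nth\<close> below).
  The value is unspecified where \<open>f\<close> is not differentiable.\<close>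

definition grad :: "('a::euclidean_space \<Rightarrow> real) \<Rightarrow> 'a \<Rightarrow> 'a" where
  "grad f x = (THE D. GDERIV f x :> D)"

lemma grad_eqI:
  assumes "GDERIV f x :> D"
  shows "grad f x = D"
  unfolding grad_def
proof (rule the_equality, rule assms)
  fix D' assume "GDERIV f x :> D'"
  then have "(\<lambda>h. h \<bullet> D') = (\<lambda>h. h \<bullet> D)"
    using assms has_derivative_unique[of f "\<lambda>h. h \<bullet> D'" x "\<lambda>h. h \<bullet> D"]
    unfolding gderiv_def by blast
  then have "h \<bullet> D' = h \<bullet> D" for h
    by (rule fun_cong)
  then show "D' = D"
    using vector_eq_ldot[of D' D] by blast
qed

lemma GDERIV_grad:
  assumes "f differentiable (at x)"
  shows "GDERIV f x :> grad f x"
proof -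
  obtain f' where f': "(f has_derivative f') (at x)"
    using assms by (auto simp: differentiable_def)
  interpret f': bounded_linear f'
    using f' by (rule has_derivative_bounded_linear)
  define D where "D = (\<Sum>b\<in>Basis. f' b *\<^sub>R b)"
  have "f' h = h \<bullet> D" for h
  proof -
    have "f' h = f' (\<Sum>b\<in>Basis. (h \<bullet> b) *\<^sub>R b)"
      by (simp add: euclidean_representation)
    also have "\<dots> = h \<bullet> D"
      by (simp add: f'.sum f'.scaleR D_def inner_sum_right mult.commute)
    finally show ?thesis .
  qed
  then have "f' = (\<lambda>h. h \<bullet> D)"
    by blast
  then have "GDERIV f x :> D"
    using f' by (simp add: gderiv_def)
  then show ?thesis
    by (simp only: grad_eqI)
qed

lemma grad_nth_nth:
  fixes f :: "real^'d^'n \<Rightarrow> real"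
  assumes "f differentiable (at E)"
  shows "((\<lambda>t. f (E + t *\<^sub>R axis i (axis j 1))) has_real_derivative grad f E $ i $ j) (at 0)"
proof -
  have "(f has_derivative (\<lambda>h. h \<bullet> grad f E)) (at (E + 0 *\<^sub>R axis i (axis j 1)))"
    using GDERIV_grad[OF assms] by (simp add: gderiv_def)
  moreover have "((\<lambda>t. E + t *\<^sub>R axis i (axis j 1)) has_derivative (\<lambda>t. t *\<^sub>R axis i (axis j 1))) (at 0)"
    by (auto intro!: derivative_eq_intros)
  ultimately have "((\<lambda>t. f (E + t *\<^sub>R axis i (axis j 1))) has_derivative
      (\<lambda>t. (t *\<^sub>R axis i (axis j 1)) \<bullet> grad f E)) (at 0)"
    by (rule has_derivative_compose[rotated])
  then show ?thesis
    by (simp add: has_field_derivative_def inner_axis' mult_commute_abs)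
qed

text \<open>An input consists of the item embedding \<open>EID\<close> and the attribute embeddings
  \<open>Ef 1, \<dots>, Ef p\<close>; the values of \<open>Ef\<close> outside \<open>{1..p}\<close> play no role.\<close>

definition loss_added ::
  "nat \<Rightarrow> ((real^'m) \<times> 'y \<Rightarrow> real) \<Rightarrow> (real^'d^'n \<Rightarrow> real^'m) \<Rightarrow> 'y
    \<Rightarrow> real^'d^'n \<Rightarrow> (nat \<Rightarrow> real^'d^'n) \<Rightarrow> real" where
  "loss_added p l G y EID Ef = l (G (EID + (\<Sum>i=1..p. Ef i)), y)"

definition loss_separate ::
  "nat \<Rightarrow> ((real^'m) \<times> 'y \<Rightarrow> real) \<Rightarrow> ((real^'d^'n) \<times> (real^'d^'n) \<Rightarrow> real^'m) \<Rightarrow> 'y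
    \<Rightarrow> real^'d^'n \<Rightarrow> (nat \<Rightarrow> real^'d^'n) \<Rightarrow> real" where
  "loss_separate p l G y EID Ef = l (G (EID, \<Sum>i=1..p. Ef i), y)"

definition ID_section ::
  "('a \<Rightarrow> (nat \<Rightarrow> 'a) \<Rightarrow> real) \<Rightarrow> (nat \<Rightarrow> 'a) \<Rightarrow> 'a \<Rightarrow> real" where
  "ID_section L Ef = (\<lambda>X. L X Ef)"

definition f_section ::
  "nat \<Rightarrow> ('a \<Rightarrow> (nat \<Rightarrow> 'a) \<Rightarrow> real) \<Rightarrow> 'a \<Rightarrow> (nat \<Rightarrow> 'a) \<Rightarrow> 'a \<Rightarrow> real" where
  "f_section i L EID Ef = (\<lambda>X. L EID (Ef(i := X)))"

definition grad_ID ::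
  "('a::euclidean_space \<Rightarrow> (nat \<Rightarrow> 'a) \<Rightarrow> real) \<Rightarrow> 'a \<Rightarrow> (nat \<Rightarrow> 'a) \<Rightarrow> 'a" where
  "grad_ID L EID Ef = grad (ID_section L Ef) EID"

definition grad_f ::
  "nat \<Rightarrow> ('a::euclidean_space \<Rightarrow> (nat \<Rightarrow> 'a) \<Rightarrow> real) \<Rightarrow> 'a \<Rightarrow> (nat \<Rightarrow> 'a) \<Rightarrow> 'a" where
  "grad_f i L EID Ef = grad (f_section i L EID Ef) (Ef i)"

end

theory Submission
  imports Defs
begin

text \<open>The loss sees the summed embeddings only through their total. With all other summands
  frozen, varying one summand means evaluating a fixed differentiable \<open>h\<close> after a
  translation, and a translation has the identity as derivative. The gradient is therefore the
  gradient of \<open>h\<close> at the translated point (\<open>grad_translate\<close>), and that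
  point is the total, whichever summand was varied (\<open>grad_sum_coordinate\<close>). In the
  added model \<open>EID\<close> is itself a summand; in the separate model it is frozen inside
  \<open>h\<close>, so only the attribute gradients are compared. Differentiability of the sections
  is carried along because \<open>grad\<close> is unspecified without it.\<close>

lemma grad_translate:
  assumes "h differentiable (at (x + c))"
  shows "(\<lambda>X. h (X + c)) differentiable (at x)"
    and "grad (\<lambda>X. h (X + c)) x = grad h (x + c)"
proof -
  have "(h has_derivative (\<lambda>u. u \<bullet> grad h (x + c))) (at (x + c))"
    using GDERIV_grad[OF assms] by (simp add: gderiv_def)
  moreover have "((\<lambda>X. X + c) has_derivative (\<lambda>u. u)) (at x)"
    by (auto intro!: derivative_eq_intros)
  ultimately have D: "((\<lambda>X. h (X + c)) has_derivative (\<lambda>u. u \<bullet> grad h (x + c))) (at x)"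
    by (rule has_derivative_compose[rotated])
  then show "(\<lambda>X. h (X + c)) differentiable (at x)"
    by (rule differentiableI)
  from D show "grad (\<lambda>X. h (X + c)) x = grad h (x + c)"
    by (intro grad_eqI) (simp add: gderiv_def)
qed

text \<open>Shows the dependence on one summand as a translation by a constant, in a form that gives
  back \<open>sum f A\<close> at \<open>X = f i\<close>.\<close>

lemma sum_fun_upd_eq:
  fixes f :: "'i \<Rightarrow> 'a::ab_group_add"
  assumes "finite A" "i \<in> A"
  shows "sum (f(i := X)) A = X + (sum f A - f i)"
proof -
  have "sum (f(i := X)) (A - {i}) = sum f (A - {i})"
    by (rule sum.cong) auto
  with assms show ?thesis
    by (simp add: sum.remove[of A i])
qed

text \<open>The source of all the equalities: the right-hand side of the gradient formula does not
  mention \<open>i\<close>.\<close>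

lemma grad_sum_coordinate:
  fixes f :: "'i \<Rightarrow> 'a::euclidean_space"
  assumes "finite A" "i \<in> A" and "h differentiable (at (sum f A))"
  shows "(\<lambda>X. h (sum (f(i := X)) A)) differentiable (at (f i))"
    and "grad (\<lambda>X. h (sum (f(i := X)) A)) (f i) = grad h (sum f A)"
proof -
  have eq: "f i + (sum f A - f i) = sum f A"
    by simp
  note translate = grad_translate[of h "f i" "sum f A - f i", unfolded eq, OF assms(3)]
  show "(\<lambda>X. h (sum (f(i := X)) A)) differentiable (at (f i))"
    and "grad (\<lambda>X. h (sum (f(i := X)) A)) (f i) = grad h (sum f A)"
    unfolding sum_fun_upd_eq[OF assms(1,2)] by (rule translate)+
qed

theorem theorem4p2:
  fixes p :: nat
    and EID :: "real^'d^'n"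
    and Ef :: "nat \<Rightarrow> real^'d^'n"
    and l :: "(real^'m) \<times> 'y \<Rightarrow> real"
    and y :: 'y
  assumes "p \<ge> 1"
    and "\<forall>z. (\<lambda>z'. l (z', y)) differentiable (at z)"
  shows
    "(\<forall>G :: real^'d^'n \<Rightarrow> real^'m. (\<forall>X. G differentiable (at X)) \<longrightarrow>
        ID_section (loss_added p l G y) Ef differentiable (at EID) \<and>
        (\<forall>i\<in>{1..p}.
           f_section i (loss_added p l G y) EID Ef differentiable (at (Ef i)) \<and>
           grad_ID (loss_added p l G y) EID Ef = grad_f i (loss_added p l G y) EID Ef))
     \<and>
     (\<forall>G :: (real^'d^'n) \<times> (real^'d^'n) \<Rightarrow> real^'m. (\<forall>X. G differentiable (at X)) \<longrightarrow>
        (\<forall>i\<in>{1..p}. f_section i (loss_separate p l G y) EID Ef differentiable (at (Ef i))) \<and>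
        (\<forall>i\<in>{1..p}. \<forall>j\<in>{1..p}.
           grad_f i (loss_separate p l G y) EID Ef = grad_f j (loss_separate p l G y) EID Ef))"
proof (rule conjI; intro allI impI)
  fix G :: "real^'d^'n \<Rightarrow> real^'m"
  assume G: "\<forall>X. G differentiable (at X)"
  define h where "h Z = l (G Z, y)" for Z
  have h: "h differentiable (at Z)" for Z
    unfolding h_def using differentiable_compose[of "\<lambda>z. l (z, y)" G] assms(2) G by blast
  \<comment> \<open>For an attribute section the outer function of the attribute sum is
    \<open>h\<close> shifted by \<open>EID\<close>, so two translations are composed in
    \<open>gf\<close>.\<close>
  have hE: "(\<lambda>S. h (S + EID)) differentiable (at S)" for S
    by (rule grad_translate(1)[OF h])
  have ID: "ID_section (loss_added p l G y) Ef = (\<lambda>X. h (X + sum Ef {1..p}))"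
    by (simp add: ID_section_def loss_added_def h_def fun_eq_iff)
  have f: "f_section i (loss_added p l G y) EID Ef = (\<lambda>X. h (sum (Ef(i := X)) {1..p} + EID))" for i
    by (simp add: f_section_def loss_added_def h_def fun_eq_iff add.commute)
  have gf: "grad_f i (loss_added p l G y) EID Ef = grad h (sum Ef {1..p} + EID)"
    if "i \<in> {1..p}" for i
    unfolding grad_f_def f
    using grad_sum_coordinate(2)[OF _ that hE] grad_translate(2)[OF h] by simp
  show "ID_section (loss_added p l G y) Ef differentiable (at EID) \<and>
      (\<forall>i\<in>{1..p}.
         f_section i (loss_added p l G y) EID Ef differentiable (at (Ef i)) \<and>
         grad_ID (loss_added p l G y) EID Ef = grad_f i (loss_added p l G y) EID Ef)"
  proof (intro conjI ballI)
    show "ID_section (loss_added p l G y) Ef differentiable (at EID)"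
      unfolding ID by (rule grad_translate(1)[OF h])
  next
    fix i assume i: "i \<in> {1..p}"
    show "f_section i (loss_added p l G y) EID Ef differentiable (at (Ef i))"
      unfolding f by (rule grad_sum_coordinate(1)[OF _ i hE]) simp
    show "grad_ID (loss_added p l G y) EID Ef = grad_f i (loss_added p l G y) EID Ef"
      \<comment> \<open>Both sides are \<open>grad h\<close> at the total embedding; only the order
        of the two summands differs.\<close>
      unfolding gf[OF i] unfolding grad_ID_def ID
      by (simp only: grad_translate(2)[OF h] add.commute)
  qed
next
  fix G :: "(real^'d^'n) \<times> (real^'d^'n) \<Rightarrow> real^'m"
  assume G: "\<forall>X. G differentiable (at X)"
  \<comment> \<open>Fixing the first argument of \<open>G\<close> leaves a function of the attribute
    sum alone, differentiable by the chain rule through the affine map from \<open>S\<close> to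
    \<open>(EID, S)\<close>.\<close>
  define h where "h S = l (G (EID, S), y)" for S
  have h: "h differentiable (at S)" for S
  proof -
    have "(\<lambda>S. (EID, S)) differentiable (at S)"
      by (rule differentiableI[OF has_derivative_Pair[OF has_derivative_const has_derivative_ident]])
    then have "(\<lambda>S. G (EID, S)) differentiable (at S)"
      using differentiable_compose[of G "\<lambda>S. (EID, S)"] G by blast
    then show ?thesis
      unfolding h_def
      using differentiable_compose[of "\<lambda>z. l (z, y)" "\<lambda>S. G (EID, S)"] assms(2) by blast
  qed
  have f: "f_section i (loss_separate p l G y) EID Ef = (\<lambda>X. h (sum (Ef(i := X)) {1..p}))" for i
    by (simp add: f_section_def loss_separate_def h_def fun_eq_iff)
  note coord = grad_sum_coordinate[OF finite_atLeastAtMost _ h]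
  show "(\<forall>i\<in>{1..p}. f_section i (loss_separate p l G y) EID Ef differentiable (at (Ef i))) \<and>
      (\<forall>i\<in>{1..p}. \<forall>j\<in>{1..p}.
         grad_f i (loss_separate p l G y) EID Ef = grad_f j (loss_separate p l G y) EID Ef)"
    \<comment> \<open>The two gradients meet in the common value
      \<open>grad h (sum Ef {1..p})\<close>.\<close>
    unfolding grad_f_def f by (intro conjI ballI coord(1) trans[OF coord(2) coord(2)[symmetric]])
qed

end
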